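(* Let $n,k\ge 1$. For any $k$-tensor $T$ on $\mathbb{R}^n$, any real $n\times n$ matrices $H_1,\dots,H_k$, any $n\times n$ orthogonal matrix $U$, and any permutation $\sigma$ on $\mathbb{N}_k$ we have the identity $$\langle T, \tilde H_1\circ_\sigma \cdots\circ_\sigma \tilde H_k\rangle = \big(U(\mathrm{Diag}^{\sigma}\,T)U^T\big)[H_1,\dots,H_k],$$ where $\tilde H_i = U^T H_i U$ for all $i=1,\dots,k$.
   Context: $\mathbb{N}_k=\{1,\dots,k\}$. A $k$-tensor $T$ on $\mathbb{R}^n$ is a multilinear real map on $(\mathbb{R}^n)^k$, identified (standard basis) with an array of real entries $T^{i_1\dots i_k}$, $1\le i_s\le n$. Scalar product: $\langle T_1,T_2\rangle=\sum_{i_1,\dots,i_k=1}^n T_1^{i_1\dots i_k}T_2^{i_1\dots i_k}$. $H^{ij}$ denotes the $(i,j)$ entry of a matrix $H$. $\sigma$-Hadamard product: let $H_{pq}$ be the matrix with $1$ in position $(p,q)$ and $0$ elsewhere. For a permutation $\sigma$ on $\mathbb{N}_k$, $(H_{p_1q_1}\circ_\sigma\cdots\circ_\sigma H_{p_kq_k})^{i_1\dots i_k}=1$ if $i_s=p_s=q_{\sigma(s)}$ for all $s=1,\dots,k$, and $0$ otherwise; the product is extended to a $k$-tensor valued map of $k$ matrix arguments, linear in each argument separately. $\mathrm{Diag}^{\sigma}T$ is the $2k$-tensor with entries, indexed by pairs of multi-indices $(i_1\dots i_k;\,j_1\dots j_k)$, equal to $T^{i_1\dots i_k}$ if $i_s=j_{\sigma(s)}$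 for all $s=1,\dots,k$, and $0$ otherwise. For an orthogonal $U$ and a $2k$-tensor $S$ with entries $S^{p_1\dots p_k;\,q_1\dots q_k}$, the $2k$-tensor $USU^T$ is defined by $(USU^T)^{i_1\dots i_k;\,j_1\dots j_k}=\sum_{p_1,q_1,\dots,p_k,q_k=1}^n S^{p_1\dots p_k;\,q_1\dots q_k}\prod_{\nu=1}^k U^{i_\nu p_\nu}U^{j_\nu q_\nu}$. A $2k$-tensor $S$ is evaluated at $k$ matrices by $S[H_1,\dots,H_k]=\sum_{p_1,q_1,\dots,p_k,q_k=1}^n S^{p_1\dots p_k;\,q_1\dots q_k}H_1^{p_1q_1}\cdots H_k^{p_kq_k}$. *)

theory Defs
  imports "HOL-Analysis.Analysis" "HOL-Combinatorics.Permutations"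
begin

text \<open>
  The finite type \<open>'n\<close> indexes the coordinates of R^n and the finite type \<open>'k\<close> the \<open>k\<close> slots
  of a tensor, so that \<open>n = CARD('n)\<close> and \<open>k = CARD('k)\<close> are at least 1. A multi-index
  \<open>i\<^sub>1 \<dots> i\<^sub>k\<close> is a function \<open>'k \<Rightarrow> 'n\<close>, and a tensor is identified with its array of entries
  in the standard basis. The two multi-indices of a 2k-tensor are kept as separate arguments.
\<close>

type_synonym ('n, 'k) tensor = "('k \<Rightarrow> 'n) \<Rightarrow> real"
type_synonym ('n, 'k) tensor2 = "('k \<Rightarrow> 'n) \<Rightarrow> ('k \<Rightarrow> 'n) \<Rightarrow> real"

definition tensor_inner :: "('n::finite, 'k::finite) tensor \<Rightarrow> ('n, 'k) tensor \<Rightarrow> real" where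
  "tensor_inner T1 T2 = (\<Sum>i\<in>UNIV. T1 i * T2 i)"

definition elem_matrix :: "'n \<Rightarrow> 'n \<Rightarrow> real ^ 'n ^ 'n" where
  "elem_matrix p q = (\<chi> i j. if i = p \<and> j = q then 1 else 0)"

definition elem_hadamard ::
    "('k \<Rightarrow> 'k) \<Rightarrow> ('k \<Rightarrow> 'n) \<Rightarrow> ('k \<Rightarrow> 'n) \<Rightarrow> ('n::finite, 'k::finite) tensor" where
  "elem_hadamard \<sigma> p q = (\<lambda>i. if \<forall>s. i s = p s \<and> p s = q (\<sigma> s) then 1 else 0)"

text \<open>
  The multilinear extension of \<open>elem_hadamard\<close>, obtained by expanding each argument as
  \<open>H s = (\<Sum>p q. H s $ p $ q *\<^sub>R elem_matrix p q)\<close>. The lemmas \<open>sigma_hadamard_elem\<close> and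
  \<open>linear_sigma_hadamard\<close> below are its two characterizing properties.
\<close>

definition sigma_hadamard ::
    "('k \<Rightarrow> 'k) \<Rightarrow> ('k \<Rightarrow> real ^ 'n ^ 'n) \<Rightarrow> ('n::finite, 'k::finite) tensor" where
  "sigma_hadamard \<sigma> H =
     (\<lambda>i. \<Sum>p\<in>UNIV. \<Sum>q\<in>UNIV. (\<Prod>s\<in>UNIV. H s $ p s $ q s) * elem_hadamard \<sigma> p q i)"

definition Diag :: "('k \<Rightarrow> 'k) \<Rightarrow> ('n::finite, 'k::finite) tensor \<Rightarrow> ('n, 'k) tensor2" where
  "Diag \<sigma> T = (\<lambda>i j. if \<forall>s. i s = j (\<sigma> s) then T i else 0)"

definition tensor_conj ::
    "real ^ 'n ^ 'n \<Rightarrow> ('n::finite, 'k::finite) tensor2 \<Rightarrow> ('n, 'k) tensor2" where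
  "tensor_conj U S =
     (\<lambda>i j. \<Sum>p\<in>UNIV. \<Sum>q\<in>UNIV. S p q * (\<Prod>\<nu>\<in>UNIV. U $ i \<nu> $ p \<nu> * U $ j \<nu> $ q \<nu>))"

definition tensor_eval ::
    "('n::finite, 'k::finite) tensor2 \<Rightarrow> ('k \<Rightarrow> real ^ 'n ^ 'n) \<Rightarrow> real" where
  "tensor_eval S H = (\<Sum>p\<in>UNIV. \<Sum>q\<in>UNIV. S p q * (\<Prod>s\<in>UNIV. H s $ p s $ q s))"

lemma sigma_hadamard_elem:
  fixes p q :: "'k::finite \<Rightarrow> 'n::finite"
  shows "sigma_hadamard \<sigma> (\<lambda>s. elem_matrix (p s) (q s)) = elem_hadamard \<sigma> p q"
proof
  fix i :: "'k \<Rightarrow> 'n"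
  have prod_eq: "(\<Prod>s\<in>UNIV. elem_matrix (p s) (q s) $ p' s $ q' s)
      = (if q' = q then if p' = p then 1 else 0 else 0)" for p' q' :: "'k \<Rightarrow> 'n"
  proof (cases "p' = p \<and> q' = q")
    case True
    then show ?thesis by (simp add: elem_matrix_def)
  next
    case False
    then obtain s where "p' s \<noteq> p s \<or> q' s \<noteq> q s" by auto
    then have "elem_matrix (p s) (q s) $ p' s $ q' s = 0"
      by (auto simp: elem_matrix_def)
    then have "(\<Prod>s\<in>UNIV. elem_matrix (p s) (q s) $ p' s $ q' s) = 0"
      by (intro prod_zero) auto
    with False show ?thesis by auto
  qed
  have "sigma_hadamard \<sigma> (\<lambda>s. elem_matrix (p s) (q s)) i
      = (\<Sum>p'\<in>UNIV. \<Sum>q'\<in>UNIV. if q' = q then if p' = p then elem_hadamard \<sigma> p' q' i else 0 else 0)"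
    unfolding sigma_hadamard_def prod_eq by (intro sum.cong) auto
  also have "\<dots> = elem_hadamard \<sigma> p q i"
    by simp
  finally show "sigma_hadamard \<sigma> (\<lambda>s. elem_matrix (p s) (q s)) i = elem_hadamard \<sigma> p q i" .
qed

lemma linear_sigma_hadamard:
  fixes H :: "'k::finite \<Rightarrow> real ^ 'n::finite ^ 'n"
  shows "linear (\<lambda>A. sigma_hadamard \<sigma> (H(t := A)) i)"
proof -
  have "(\<Prod>s\<in>UNIV. (H(t := A)) s $ p s $ q s)
      = A $ p t $ q t * (\<Prod>s\<in>UNIV - {t}. H s $ p s $ q s)"
    for A :: "real ^ 'n ^ 'n" and p q
    by (subst prod.remove[of _ t]) (auto intro!: prod.cong)
  then show ?thesis
    unfolding sigma_hadamard_def
    by (intro linearI)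
      (simp_all add: algebra_simps sum.distrib sum_distrib_left)
qed

end

theory Submission
  imports Defs
begin

text \<open>
  Summing the elementary products against \<open>T\<close> recovers the entries of \<open>Diag \<sigma> T\<close>, so the left-hand
  side is \<open>Diag \<sigma> T\<close> evaluated at the conjugated matrices. For an arbitrary 2k-tensor \<open>S\<close> and
  an arbitrary matrix \<open>U\<close>, evaluating \<open>S\<close> at the matrices \<open>U\<^sup>T H U\<close> is evaluating
  \<open>U S U\<^sup>T\<close> at the matrices \<open>H\<close>: expand each entry of \<open>U\<^sup>T H U\<close>, turn the product of sums
  into a sum over multi-indices, and exchange the order of summation.
\<close>

text \<open>Distributivity: expanding the product selects one index in each factor, and such a
  selection is a function \<open>g\<close>.\<close>

lemma prod_sum_UNIV:
  fixes f :: "'k::finite \<Rightarrow> 'n::finite \<Rightarrow> 'a::comm_semiring_1"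
  shows "(\<Prod>s\<in>UNIV. \<Sum>x\<in>UNIV. f s x) = (\<Sum>g\<in>UNIV. \<Prod>s\<in>UNIV. f s (g s))"
  using prod_sum_PiE[of UNIV "\<lambda>_. UNIV" f] by (simp add: PiE_UNIV_domain)

lemma tensor_inner_sigma_hadamard:
  "tensor_inner T (sigma_hadamard \<sigma> H) = tensor_eval (Diag \<sigma> T) H"
proof -
  have entry: "(\<Sum>i\<in>UNIV. T i * elem_hadamard \<sigma> p q i) = Diag \<sigma> T p q" for p q
  proof -
    \<comment> \<open>The slotwise conditions \<open>i s = p s\<close> amount to
      \<open>i = p\<close>, so the sum over \<open>i\<close> collapses to one term.\<close>
    have "elem_hadamard \<sigma> p q i = (if i = p \<and> (\<forall>s. p s = q (\<sigma> s)) then 1 else 0)" for i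
      by (auto simp: elem_hadamard_def fun_eq_iff)
    then have "T i * elem_hadamard \<sigma> p q i = (if i = p then Diag \<sigma> T p q else 0)" for i
      by (auto simp: Diag_def)
    then show ?thesis by simp
  qed
  have "tensor_inner T (sigma_hadamard \<sigma> H)
      = (\<Sum>i\<in>UNIV. \<Sum>p\<in>UNIV. \<Sum>q\<in>UNIV.
          T i * elem_hadamard \<sigma> p q i * (\<Prod>s\<in>UNIV. H s $ p s $ q s))"
    unfolding tensor_inner_def sigma_hadamard_def
    by (simp add: sum_distrib_left mult_ac)
  also have "\<dots> = (\<Sum>p\<in>UNIV. \<Sum>i\<in>UNIV. \<Sum>q\<in>UNIV.
          T i * elem_hadamard \<sigma> p q i * (\<Prod>s\<in>UNIV. H s $ p s $ q s))"
    by (rule sum.swap)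
  also have "\<dots> = (\<Sum>p\<in>UNIV. \<Sum>q\<in>UNIV. \<Sum>i\<in>UNIV.
          T i * elem_hadamard \<sigma> p q i * (\<Prod>s\<in>UNIV. H s $ p s $ q s))"
    by (intro sum.cong refl sum.swap)
  also have "\<dots> = tensor_eval (Diag \<sigma> T) H"
    unfolding tensor_eval_def by (simp add: entry flip: sum_distrib_right)
  finally show ?thesis .
qed

text \<open>The entries of \<open>U\<close> are grouped so that a product over slots splits into the
  weight in \<open>tensor_conj\<close> and the entries of \<open>H\<close>.\<close>

lemma transpose_matrix_matrix_nth:
  fixes A U :: "'a::comm_semiring_1 ^ 'n ^ 'n"
  shows "(transpose U ** A ** U) $ p $ q = (\<Sum>i\<in>UNIV. \<Sum>j\<in>UNIV. U $ i $ p * U $ j $ q * A $ i $ j)"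
proof -
  have "(transpose U ** A ** U) $ p $ q = (\<Sum>j\<in>UNIV. \<Sum>i\<in>UNIV. U $ i $ p * U $ j $ q * A $ i $ j)"
    by (simp add: matrix_matrix_mult_def transpose_def sum_distrib_left mult_ac)
  also have "\<dots> = (\<Sum>i\<in>UNIV. \<Sum>j\<in>UNIV. U $ i $ p * U $ j $ q * A $ i $ j)"
    by (rule sum.swap)
  finally show ?thesis .
qed

lemma tensor_eval_conj:
  "tensor_eval S (\<lambda>s. transpose U ** H s ** U) = tensor_eval (tensor_conj U S) H"
proof -
  define F where "F p q i j = S p q * (\<Prod>s\<in>UNIV. U $ i s $ p s * U $ j s $ q s)
      * (\<Prod>s\<in>UNIV. H s $ i s $ j s)" for p q i j
  have "tensor_eval S (\<lambda>s. transpose U ** H s ** U)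
      = (\<Sum>p\<in>UNIV. \<Sum>q\<in>UNIV. \<Sum>i\<in>UNIV. \<Sum>j\<in>UNIV. F p q i j)"
    unfolding tensor_eval_def F_def transpose_matrix_matrix_nth
    by (simp add: prod_sum_UNIV sum_distrib_left prod.distrib mult.assoc)
  \<comment> \<open>Pairing the indices lets a single exchange move both inner sums past both outer
    ones.\<close>
  also have "\<dots> = (\<Sum>(p, q)\<in>UNIV. \<Sum>(i, j)\<in>UNIV. F p q i j)"
    by (simp flip: sum.cartesian_product UNIV_Times_UNIV)
  also have "\<dots> = (\<Sum>(i, j)\<in>UNIV. \<Sum>(p, q)\<in>UNIV. F p q i j)"
    unfolding case_prod_beta by (rule sum.swap)
  also have "\<dots> = (\<Sum>i\<in>UNIV. \<Sum>j\<in>UNIV. \<Sum>p\<in>UNIV. \<Sum>q\<in>UNIV. F p q i j)"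
    by (simp flip: sum.cartesian_product UNIV_Times_UNIV)
  also have "\<dots> = tensor_eval (tensor_conj U S) H"
    unfolding tensor_eval_def tensor_conj_def F_def by (simp add: sum_distrib_right)
  finally show ?thesis .
qed

theorem theorem4p4:
  fixes T :: "('n::finite, 'k::finite) tensor"
    and H :: "'k \<Rightarrow> real ^ 'n ^ 'n"
    and U :: "real ^ 'n ^ 'n"
    and \<sigma> :: "'k \<Rightarrow> 'k"
  assumes "orthogonal_matrix U"
    and "\<sigma> permutes UNIV"
  shows "tensor_inner T (sigma_hadamard \<sigma> (\<lambda>s. transpose U ** H s ** U))
       = tensor_eval (tensor_conj U (Diag \<sigma> T)) H"
  unfolding tensor_inner_sigma_hadamard by (rule tensor_eval_conj)

end
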